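(* Let $M$ be a Minkowski plane with origin $o$ and unit circle $S$. Let $a,b,c\neq o$ be points of $M$ with $a\neq c$, such that the ray $[ob\rangle$ lies between the rays $[oa\rangle$ and $[oc\rangle$, and suppose that $\|b\|=\|c\|$. Then $\|a-b\|\leq\|a-c\|$, with equality if and only if one of the following holds: (1) $b=c$; (2) $o$ and $b$ are on opposite sides of the line through $a$ and $c$, and the segment $[\widehat{c-a},\ \widehat{b}\,]$ is contained in $S$; (3) $o$ and $b$ are on the same side of the line through $a$ and $c$, and the segment $[\widehat{c-a},\ \widehat{-c}\,]$ is contained in $S$. In particular, if the plane is strictly convex, then the inequality is strict whenever $b\neq c$.
   Context: A Minkowski plane is a two-dimensional real normed space $(M,\|\cdot\|)$; its unit circle is $S=\{x:\|x\|=1\}$. For $x\neq o$, $\widehat{x}=x/\|x\|$. $[x,y]$ denotes the closed straight segment with endpoints $x,y$ (a single point if $x=y$). $[ox\rangle$ is the ray with origin $o$ passing through $x$. The ray $[ob\rangle$ is between $[oa\rangle$ and $[oc\rangle$ if $b=\lambda a+\mu c$ for some $\lambda,\mu\geq 0$. "Sides" of a line refer to the two open half-planes it bounds. The plane is strictly convex if $\|x+y\|=\|x\|+\|y\|$ implies that $x,y$ are linearly dependent. *)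

theory Defs
  imports "HOL-Analysis.Analysis"
begin

text \<open>
  A Minkowski plane is a type of class \<open>real_normed_vector\<close> with \<open>dim UNIV = 2\<close>.  The class
  \<open>euclidean_space\<close> would be too special, since it forces the norm to come from an inner product.
  An infinite-dimensional space has \<open>dim UNIV = 0\<close>, so the equation really means dimension two.
  The normalisation of \<open>x\<close> (that is, \<open>x\<close> divided by its norm) is the library's \<open>sgn x\<close>, and the
  unit circle is \<open>sphere 0 1\<close>.
\<close>

definition ray_between :: "'a::real_vector \<Rightarrow> 'a \<Rightarrow> 'a \<Rightarrow> bool" where
  "ray_between a b c \<longleftrightarrow> (\<exists>l m. 0 \<le> l \<and> 0 \<le> m \<and> b = l *\<^sub>R a + m *\<^sub>R c)"

text \<open>
  Replacing \<open>(f, k)\<close> by \<open>(- f, - k)\<close> in the next definition yields the other half-plane, so a line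
  in a plane has exactly two.  A point of the line itself lies in neither of them.
\<close>

definition open_half_planes :: "'a::real_vector set \<Rightarrow> 'a set set" where
  "open_half_planes L =
     {H. \<exists>(f :: 'a \<Rightarrow> real) k. linear f \<and> f \<noteq> (\<lambda>_. 0) \<and> L = {z. f z = k} \<and> H = {z. f z < k}}"

definition same_side :: "'a::real_vector set \<Rightarrow> 'a \<Rightarrow> 'a \<Rightarrow> bool" where
  "same_side L x y \<longleftrightarrow> (\<exists>H\<in>open_half_planes L. x \<in> H \<and> y \<in> H)"

definition opposite_sides :: "'a::real_vector set \<Rightarrow> 'a \<Rightarrow> 'a \<Rightarrow> bool" where
  "opposite_sides L x y \<longleftrightarrow>
     (\<exists>H\<in>open_half_planes L. \<exists>H'\<in>open_half_planes L. H \<noteq> H' \<and> x \<in> H \<and> y \<in> H')"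

text \<open>
  Linear dependence of the pair \<open>x, y\<close> is meant as a family; \<open>dependent {x, y}\<close> would
  be false for \<open>x = y \<noteq> 0\<close>.
\<close>

definition linearly_dependent_pair :: "'a::real_vector \<Rightarrow> 'a \<Rightarrow> bool" where
  "linearly_dependent_pair x y \<longleftrightarrow>
     (\<exists>s t. (s \<noteq> 0 \<or> t \<noteq> 0) \<and> s *\<^sub>R x + t *\<^sub>R y = 0)"

definition strictly_convex :: "'a::real_normed_vector itself \<Rightarrow> bool" where
  "strictly_convex _ \<longleftrightarrow>
     (\<forall>x y :: 'a. norm (x + y) = norm x + norm y \<longrightarrow> linearly_dependent_pair x y)"

end

theory Submission
  imports Defs
begin

text \<open>
  Write \<open>b = l a + m c\<close> with \<open>l > 0\<close>.  If \<open>l + m > 1\<close>, the segments \<open>[a, c]\<close> and \<open>[o, b]\<close> meet at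
  \<open>p = b / (l + m)\<close>, and adding the triangle inequalities for \<open>a, p, b\<close> and \<open>o, p, c\<close> gives the
  claim.  If \<open>l + m < 1\<close>, the ray from \<open>c\<close> through \<open>b\<close> meets \<open>[o, a]\<close> in a point \<open>q\<close>; convexity of the
  norm along \<open>c, b, q\<close> gives \<open>norm q \<ge> norm c\<close>, whence \<open>norm (a - q) \<le> norm (a - c)\<close>, and convexity
  of the distance to \<open>a\<close> finishes the argument.  In both cases equality comes down to additivity of
  the norm on a pair of vectors, that is, to a segment contained in the unit circle.
\<close>

lemma norm_add_eq_imp_norm_scaleR_add_eq:
  fixes x y :: "'a::real_normed_vector"
  assumes "norm (x + y) = norm x + norm y" "0 \<le> s" "0 \<le> t"
  shows "norm (s *\<^sub>R x + t *\<^sub>R y) = s * norm x + t * norm y"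
proof -
  have ge: "s * norm x + t * norm y \<le> norm (s *\<^sub>R x + t *\<^sub>R y)"
    if "norm (x + y) = norm x + norm y" "0 \<le> s" "s \<le> t" for s t and x y :: 'a
  proof -
    have "t *\<^sub>R (x + y) = (s *\<^sub>R x + t *\<^sub>R y) + (t - s) *\<^sub>R x"
      by (simp add: algebra_simps)
    then have "norm (t *\<^sub>R (x + y)) \<le> norm (s *\<^sub>R x + t *\<^sub>R y) + norm ((t - s) *\<^sub>R x)"
      by (metis norm_triangle_ineq)
    then have "t * norm (x + y) \<le> norm (s *\<^sub>R x + t *\<^sub>R y) + (t - s) * norm x"
      using that unfolding norm_scaleR by simp
    then show ?thesis
      unfolding that(1) by (simp add: algebra_simps)
  qed
  have "s * norm x + t * norm y \<le> norm (s *\<^sub>R x + t *\<^sub>R y)"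
    using ge[of x y s t] ge[of y x t s] assms by (cases "s \<le> t") (simp_all add: add.commute)
  moreover have "norm (s *\<^sub>R x + t *\<^sub>R y) \<le> s * norm x + t * norm y"
    using norm_triangle_ineq[of "s *\<^sub>R x" "t *\<^sub>R y"] assms by simp
  ultimately show ?thesis by simp
qed

lemma norm_scaleR_add_eq_iff:
  fixes x y :: "'a::real_normed_vector"
  assumes "0 < s" "0 < t"
  shows "norm (s *\<^sub>R x + t *\<^sub>R y) = s * norm x + t * norm y \<longleftrightarrow> norm (x + y) = norm x + norm y"
proof
  assume "norm (s *\<^sub>R x + t *\<^sub>R y) = s * norm x + t * norm y"
  then have "norm (s *\<^sub>R x + t *\<^sub>R y) = norm (s *\<^sub>R x) + norm (t *\<^sub>R y)"
    using assms by simp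
  from norm_add_eq_imp_norm_scaleR_add_eq[OF this, of "1 / s" "1 / t"]
  show "norm (x + y) = norm x + norm y"
    using assms by simp
qed (use assms in \<open>simp add: norm_add_eq_imp_norm_scaleR_add_eq\<close>)

lemma closed_segment_sgn_subset_sphere_iff:
  fixes x y :: "'a::real_normed_vector"
  assumes "x \<noteq> 0" "y \<noteq> 0"
  shows "closed_segment (sgn x) (sgn y) \<subseteq> sphere 0 1 \<longleftrightarrow> norm (x + y) = norm x + norm y"
proof
  assume sub: "closed_segment (sgn x) (sgn y) \<subseteq> sphere 0 1"
  have "(1 / 2) *\<^sub>R sgn x + (1 / 2) *\<^sub>R sgn y \<in> closed_segment (sgn x) (sgn y)"
    unfolding closed_segment_def by (auto intro!: exI[of _ "1 / 2"])
  with sub have "norm ((1 / 2) *\<^sub>R sgn x + (1 / 2) *\<^sub>R sgn y) = 1"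
    by auto
  then have "norm ((1 / 2 / norm x) *\<^sub>R x + (1 / 2 / norm y) *\<^sub>R y)
      = 1 / 2 / norm x * norm x + 1 / 2 / norm y * norm y"
    using assms by (simp add: sgn_div_norm inverse_eq_divide)
  then show "norm (x + y) = norm x + norm y"
    by (subst (asm) norm_scaleR_add_eq_iff) (use assms in auto)
next
  assume add: "norm (x + y) = norm x + norm y"
  show "closed_segment (sgn x) (sgn y) \<subseteq> sphere 0 1"
  proof
    fix z assume "z \<in> closed_segment (sgn x) (sgn y)"
    then obtain u where u: "0 \<le> u" "u \<le> 1" and z: "z = (1 - u) *\<^sub>R sgn x + u *\<^sub>R sgn y"
      unfolding closed_segment_def by auto
    have "norm z = norm (((1 - u) / norm x) *\<^sub>R x + (u / norm y) *\<^sub>R y)"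
      by (simp add: z sgn_div_norm divide_inverse)
    also have "\<dots> = 1"
      using norm_add_eq_imp_norm_scaleR_add_eq[OF add, of "(1 - u) / norm x" "u / norm y"] u assms
      by simp
    finally show "z \<in> sphere 0 1" by simp
  qed
qed

lemma norm_diff_le_beyond_line:
  fixes a b c :: "'a::real_normed_vector"
  assumes b: "b = l *\<^sub>R a + m *\<^sub>R c" and l: "0 < l" and m: "0 \<le> m" and lm: "1 < l + m"
    and eq: "norm b = norm c"
  shows "norm (a - b) \<le> norm (a - c)"
    and "norm (a - b) = norm (a - c) \<longleftrightarrow> norm ((c - a) + b) = norm (c - a) + norm b"
proof -
  define S where "S = l + m"
  have S: "S > 1" using lm by (simp add: S_def)
  have Sb: "b - S *\<^sub>R a = m *\<^sub>R (c - a)" "S *\<^sub>R c - b = l *\<^sub>R (c - a)"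
    unfolding b S_def by (simp_all add: algebra_simps)
  have ba: "b - a = (m / S) *\<^sub>R (c - a) + (1 - 1 / S) *\<^sub>R b"
  proof -
    have "(m / S) *\<^sub>R (c - a) = (1 / S) *\<^sub>R (b - S *\<^sub>R a)"
      unfolding Sb by simp
    then show ?thesis using S by (simp add: algebra_simps)
  qed
  have c: "c = (l / S) *\<^sub>R (c - a) + (1 / S) *\<^sub>R b"
  proof -
    have "(l / S) *\<^sub>R (c - a) = (1 / S) *\<^sub>R (S *\<^sub>R c - b)"
      unfolding Sb by simp
    then show ?thesis using S by (simp add: algebra_simps)
  qed
  have "(m + l) / S = 1"
    using S unfolding S_def by simp
  then have "m / S + l / S = 1"
    unfolding add_divide_distrib .
  then have sum: "m / S * r + l / S * r = r" for r :: real
    by (metis distrib_right mult_1)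
  have nonneg: "0 \<le> m / S" "0 \<le> 1 - 1 / S" "0 \<le> l / S" "0 \<le> 1 / S"
    using S l m by auto
  have le1: "norm (b - a) \<le> m / S * norm (c - a) + (1 - 1 / S) * norm b"
    using norm_triangle_ineq[of "(m / S) *\<^sub>R (c - a)" "(1 - 1 / S) *\<^sub>R b"]
    unfolding ba[symmetric] norm_scaleR abs_of_nonneg[OF nonneg(1)] abs_of_nonneg[OF nonneg(2)] .
  have le2: "norm c \<le> l / S * norm (c - a) + 1 / S * norm b"
    using norm_triangle_ineq[of "(l / S) *\<^sub>R (c - a)" "(1 / S) *\<^sub>R b"]
    unfolding c[symmetric] norm_scaleR abs_of_nonneg[OF nonneg(3)] abs_of_nonneg[OF nonneg(4)] .
  have distr: "(1 - 1 / S) * norm b = norm b - 1 / S * norm b"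
    by (simp add: left_diff_distrib)
  have "norm (b - a) \<le> norm (c - a)"
    using le1 le2 eq sum[of "norm (c - a)"] distr by linarith
  then show "norm (a - b) \<le> norm (a - c)"
    by (simp add: norm_minus_commute)
  have "norm (b - a) = norm (c - a) \<longleftrightarrow> norm ((c - a) + b) = norm (c - a) + norm b"
  proof
    assume "norm (b - a) = norm (c - a)"
    then have "norm c = l / S * norm (c - a) + 1 / S * norm b"
      using le1 le2 eq sum[of "norm (c - a)"] distr by linarith
    then have "norm ((l / S) *\<^sub>R (c - a) + (1 / S) *\<^sub>R b) = l / S * norm (c - a) + 1 / S * norm b"
      unfolding c[symmetric] .
    then show "norm ((c - a) + b) = norm (c - a) + norm b"
      by (subst (asm) norm_scaleR_add_eq_iff) (use l S in auto)
  next
    assume add: "norm ((c - a) + b) = norm (c - a) + norm b"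
    have "norm (b - a) = m / S * norm (c - a) + (1 - 1 / S) * norm b"
      by (subst ba, rule norm_add_eq_imp_norm_scaleR_add_eq[OF add]) (use m S in auto)
    moreover have "norm c = l / S * norm (c - a) + 1 / S * norm b"
      by (subst c, rule norm_add_eq_imp_norm_scaleR_add_eq[OF add]) (use l S in auto)
    ultimately show "norm (b - a) = norm (c - a)"
      using eq sum[of "norm (c - a)"] distr by linarith
  qed
  then show "norm (a - b) = norm (a - c) \<longleftrightarrow> norm ((c - a) + b) = norm (c - a) + norm b"
    by (simp add: norm_minus_commute)
qed

lemma norm_diff_le_before_line:
  fixes a b c :: "'a::real_normed_vector"
  assumes b: "b = l *\<^sub>R a + m *\<^sub>R c" and l: "0 \<le> l" and m: "0 \<le> m" and lm: "l + m < 1"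
    and eq: "norm b = norm c"
  shows "norm (a - b) \<le> norm (a - c)"
    and "norm (a - b) = norm (a - c) \<longleftrightarrow> norm ((c - a) + (- c)) = norm (c - a) + norm (- c)"
proof -
  have m1: "m < 1" using l lm by simp
  have "norm c \<le> l * norm a + m * norm c"
    using norm_triangle_ineq[of "l *\<^sub>R a" "m *\<^sub>R c"] l m by (simp add: b[symmetric] eq)
  then have q: "(1 - m) * norm c \<le> l * norm a"
    by (simp add: algebra_simps)
  have tri: "norm a \<le> norm (a - c) + norm c"
    using norm_triangle_ineq[of "a - c" c] by simp
  have "a - b = m *\<^sub>R (a - c) + (1 - l - m) *\<^sub>R a"
    unfolding b by (simp add: algebra_simps)
  then have ab: "norm (a - b) \<le> m * norm (a - c) + (1 - l - m) * norm a"
    using norm_triangle_ineq[of "m *\<^sub>R (a - c)" "(1 - l - m) *\<^sub>R a"] m lm by simp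
  have "(1 - l - m) * norm a \<le> (1 - m) * (norm a - norm c)"
    using q by (simp add: algebra_simps)
  then have ab': "norm (a - b) \<le> m * norm (a - c) + (1 - m) * (norm a - norm c)"
    using ab by linarith
  have "(1 - m) * (norm a - norm c) \<le> (1 - m) * norm (a - c)"
    using tri m1 by (intro mult_left_mono) auto
  with ab' show le: "norm (a - b) \<le> norm (a - c)"
    by (simp add: algebra_simps)
  have "norm (a - b) = norm (a - c) \<longleftrightarrow> norm a = norm (a - c) + norm c"
  proof
    assume "norm (a - b) = norm (a - c)"
    with ab' have "(1 - m) * norm (a - c) \<le> (1 - m) * (norm a - norm c)"
      by (simp add: algebra_simps)
    then show "norm a = norm (a - c) + norm c"
      using tri m1 by simp
  next
    assume "norm a = norm (a - c) + norm c"
    then show "norm (a - b) = norm (a - c)"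
      using norm_triangle_ineq[of "a - b" b] le eq by simp
  qed
  then show "norm (a - b) = norm (a - c) \<longleftrightarrow> norm ((c - a) + (- c)) = norm (c - a) + norm (- c)"
    by (simp add: norm_minus_commute)
qed

lemma span_pair_eq_UNIV:
  fixes x y :: "'a::real_vector"
  assumes dim: "dim (UNIV :: 'a set) = 2" and ind: "independent {x, y}" and "x \<noteq> y"
  shows "span {x, y} = UNIV"
proof -
  obtain B :: "'a set" where B: "independent B" "UNIV \<subseteq> span B" "card B = 2"
    using basis_exists[of "UNIV :: 'a set"] dim by metis
  have "finite B" using B(3) card.infinite by fastforce
  show ?thesis
  proof (rule ccontr)
    assume "span {x, y} \<noteq> UNIV"
    then obtain z where z: "z \<notin> span {x, y}" by auto
    then have "independent (insert z {x, y})"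
      using ind by (rule independent_insertI)
    then have "card (insert z {x, y}) \<le> card B"
      using independent_span_bound[OF \<open>finite B\<close>] B(2) by blast
    moreover have "z \<noteq> x" "z \<noteq> y"
      using z by (auto simp: span_base)
    ultimately show False
      using \<open>x \<noteq> y\<close> B(3) by simp
  qed
qed

lemma independent_pair_iff:
  fixes x y :: "'a::real_vector"
  assumes "x \<noteq> y"
  shows "independent {x, y} \<longleftrightarrow> \<not> linearly_dependent_pair x y"
proof -
  have dep: "dependent {x, y} \<longleftrightarrow> (\<exists>u. (u x \<noteq> 0 \<or> u y \<noteq> 0) \<and> u x *\<^sub>R x + u y *\<^sub>R y = 0)"
    using assms by (subst dependent_finite) simp_all
  have "dependent {x, y} \<longleftrightarrow> linearly_dependent_pair x y"
  proof
    assume "linearly_dependent_pair x y"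
    then obtain s t where "s \<noteq> 0 \<or> t \<noteq> 0" "s *\<^sub>R x + t *\<^sub>R y = 0"
      unfolding linearly_dependent_pair_def by blast
    then show "dependent {x, y}"
      unfolding dep using assms by (intro exI[of _ "\<lambda>z. if z = x then s else t"]) auto
  qed (unfold dep linearly_dependent_pair_def, blast)
  then show ?thesis by simp
qed

lemma affine_hull_pair_eq_level_set:
  fixes a c :: "'a::real_vector"
  assumes dim: "dim (UNIV :: 'a set) = 2" and ind: "independent {a, c}" and "a \<noteq> c"
  obtains F :: "'a \<Rightarrow> real"
  where "linear F" "F a = 1" "F c = 1" "affine hull {a, c} = {z. F z = 1}"
proof -
  obtain F :: "'a \<Rightarrow> real" where F: "linear F" "\<forall>x\<in>{a, c}. F x = 1"
    using linear_independent_extend[OF ind, of "\<lambda>_. 1"] by blast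
  interpret linear F by (fact F(1))
  have Fa: "F a = 1" and Fc: "F c = 1" using F(2) by auto
  have "z \<in> affine hull {a, c} \<longleftrightarrow> F z = 1" for z
  proof -
    have "z \<in> span {a, c}" using span_pair_eq_UNIV[OF assms] by simp
    then obtain s t where z: "z = s *\<^sub>R a + t *\<^sub>R c"
      by (auto simp: span_insert span_singleton algebra_simps)
    have "F z = s + t" by (simp add: z add scale Fa Fc)
    moreover have "z \<in> affine hull {a, c} \<Longrightarrow> F z = 1"
      by (auto simp: affine_hull_2 add scale Fa Fc)
    ultimately show ?thesis
      using z by (auto simp: affine_hull_2)
  qed
  then show thesis using that F(1) Fa Fc by blast
qed

lemma open_half_planes_level_set:
  fixes F :: "'a::real_vector \<Rightarrow> real"
  assumes F: "linear F" and p: "F p = 1"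
  shows "open_half_planes {z. F z = 1} = {{z. F z < 1}, {z. F z > 1}}"
proof
  interpret F: linear F by (fact F)
  show "open_half_planes {z. F z = 1} \<subseteq> {{z. F z < 1}, {z. F z > 1}}"
  proof
    fix H assume "H \<in> open_half_planes {z. F z = 1}"
    then obtain f :: "'a \<Rightarrow> real" and k where f: "linear f" and f0: "f \<noteq> (\<lambda>_. 0)"
      and L: "{z. F z = 1} = {z. f z = k}" and H: "H = {z. f z < k}"
      unfolding open_half_planes_def by blast
    interpret f: linear f by (fact f)
    have L': "F z = 1 \<longleftrightarrow> f z = k" for z using L by (simp add: set_eq_iff)
    have fF: "f z = k * F z" for z
    proof -
      have "F (z + (1 - F z) *\<^sub>R p) = 1"
        by (simp add: F.add F.scale p)
      then have "f (z + (1 - F z) *\<^sub>R p) = k" by (simp only: L')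
      moreover have "f p = k" using p by (simp only: L')
      ultimately have "f z + (1 - F z) * k = k" by (simp add: f.add f.scale)
      then show ?thesis by (simp add: algebra_simps)
    qed
    have "k \<noteq> 0"
    proof
      assume "k = 0"
      then have "f = (\<lambda>_. 0)" by (intro ext) (simp add: fF)
      with f0 show False by contradiction
    qed
    then consider "k > 0" | "k < 0" by linarith
    then have "(\<forall>z. f z < k \<longleftrightarrow> F z < 1) \<or> (\<forall>z. f z < k \<longleftrightarrow> F z > 1)"
      using mult_less_cancel_left_pos[of k _ 1] mult_less_cancel_left_neg[of k _ 1]
      by cases (simp_all add: fF)
    then show "H \<in> {{z. F z < 1}, {z. F z > 1}}"
      unfolding H by auto
  qed
  have "F \<noteq> (\<lambda>_. 0)" using p by auto
  then have "{z. F z < 1} \<in> open_half_planes {z. F z = 1}"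
    using F unfolding open_half_planes_def by blast
  moreover have "{z. F z > 1} \<in> open_half_planes {z. F z = 1}"
    unfolding open_half_planes_def mem_Collect_eq
  proof (intro exI conjI)
    show "linear (\<lambda>z. - F z)" using F by (rule linear_compose_neg)
    show "(\<lambda>z. - F z) \<noteq> (\<lambda>_. 0)"
      using p by (auto dest: fun_cong[of _ _ p])
    show "{z. F z = 1} = {z. - F z = - 1}" by auto
    show "{z. F z > 1} = {z. - F z < - 1}" by auto
  qed
  ultimately show "{{z. F z < 1}, {z. F z > 1}} \<subseteq> open_half_planes {z. F z = 1}"
    by simp
qed

lemma sides_of_level_set:
  fixes F :: "'a::real_vector \<Rightarrow> real"
  assumes F: "linear F" and p: "F p = 1"
  shows "same_side {z. F z = 1} 0 x \<longleftrightarrow> F x < 1"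
    and "opposite_sides {z. F z = 1} 0 x \<longleftrightarrow> F x > 1"
proof -
  have F0: "F 0 = 0" using F by (rule linear_0)
  show "same_side {z. F z = 1} 0 x \<longleftrightarrow> F x < 1"
    using F0 by (auto simp: same_side_def open_half_planes_level_set[OF assms])
  have "{z. F z < 1} \<noteq> {z. F z > 1}"
    using F0 unfolding set_eq_iff by (intro notI) (drule spec[of _ 0], simp)
  then show "opposite_sides {z. F z = 1} 0 x \<longleftrightarrow> F x > 1"
    using F0 by (auto simp: opposite_sides_def open_half_planes_level_set[OF assms])
qed

lemma no_sides_on_line:
  assumes "x \<in> L"
  shows "\<not> same_side L x y" and "\<not> opposite_sides L x y"
  using assms by (auto simp: same_side_def opposite_sides_def open_half_planes_def)

lemma proportional_if_linearly_dependent_pair: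
  assumes "linearly_dependent_pair x y" "y \<noteq> 0"
  obtains r where "x = r *\<^sub>R y"
proof -
  obtain s t where st: "s \<noteq> 0 \<or> t \<noteq> 0" "s *\<^sub>R x + t *\<^sub>R y = 0"
    using assms(1) unfolding linearly_dependent_pair_def by auto
  have "s \<noteq> 0" using st assms(2) by auto
  have "s *\<^sub>R x = (- t) *\<^sub>R y" using st(2) by (simp add: eq_neg_iff_add_eq_0)
  then have "x = (- t / s) *\<^sub>R y"
    using \<open>s \<noteq> 0\<close> by (metis divide_inverse_commute scaleR_scaleR scaleR_one left_inverse)
  then show thesis by (rule that)
qed

lemma zero_in_affine_hull_proportional:
  fixes c :: "'a::real_vector"
  assumes "r *\<^sub>R c \<noteq> c"
  shows "0 \<in> affine hull {r *\<^sub>R c, c}"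
proof -
  have "r \<noteq> 1" using assms by auto
  then have "1 / (1 - r) + - r / (1 - r) = 1"
    by (simp add: divide_simps)
  moreover have "(1 / (1 - r)) *\<^sub>R (r *\<^sub>R c) + (- r / (1 - r)) *\<^sub>R c = 0"
    by simp
  ultimately show ?thesis
    unfolding affine_hull_2 mem_Collect_eq by metis
qed

lemma norm_diff_less_proportional:
  fixes a b c :: "'a::real_normed_vector"
  assumes "a = r *\<^sub>R c" "ray_between a b c" "norm b = norm c" "b \<noteq> c" "a \<noteq> 0"
  shows "norm (a - b) < norm (a - c)"
proof -
  obtain l m where lm: "0 \<le> l" "0 \<le> m" "b = l *\<^sub>R a + m *\<^sub>R c"
    using assms(2) unfolding ray_between_def by auto
  have b: "b = (l * r + m) *\<^sub>R c" using lm assms(1) by (simp add: algebra_simps)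
  have c: "c \<noteq> 0" "r \<noteq> 0" using assms by auto
  have "\<bar>l * r + m\<bar> = 1" using b c assms(3) by simp
  moreover have "l * r + m \<noteq> 1" using b assms(4) by auto
  ultimately have k: "l * r + m = - 1" by linarith
  then have "l * r < 0" using lm by linarith
  then have "r < 0" using lm(1) by (simp add: mult_less_0_iff)
  then have "\<bar>r + 1\<bar> < \<bar>r - 1\<bar>" by linarith
  moreover have "a - b = (r + 1) *\<^sub>R c" "a - c = (r - 1) *\<^sub>R c"
    unfolding b k assms(1) by (simp_all add: algebra_simps)
  ultimately show ?thesis using c by simp
qed

theorem proposition31:
  fixes a b c :: "'a::real_normed_vector"
  assumes "dim (UNIV :: 'a set) = 2"
    and "a \<noteq> 0" and "b \<noteq> 0" and "c \<noteq> 0" and "a \<noteq> c"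
    and "ray_between a b c"
    and "norm b = norm c"
  shows "norm (a - b) \<le> norm (a - c)
    \<and> (norm (a - b) = norm (a - c) \<longleftrightarrow>
        b = c
        \<or> (opposite_sides (affine hull {a, c}) 0 b
            \<and> closed_segment (sgn (c - a)) (sgn b) \<subseteq> sphere 0 1)
        \<or> (same_side (affine hull {a, c}) 0 b
            \<and> closed_segment (sgn (c - a)) (sgn (- c)) \<subseteq> sphere 0 1))
    \<and> (strictly_convex TYPE('a) \<longrightarrow> b \<noteq> c \<longrightarrow> norm (a - b) < norm (a - c))"
proof (cases "b = c \<or> linearly_dependent_pair a c")
  case True
  show ?thesis
  proof (cases "b = c")
    case False
    with True obtain r where r: "a = r *\<^sub>R c"
      using proportional_if_linearly_dependent_pair assms(4) by metis
    have "0 \<in> affine hull {a, c}"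
      using zero_in_affine_hull_proportional assms(5) r by metis
    then show ?thesis
      using norm_diff_less_proportional[OF r assms(6,7) False assms(2)] False
      by (simp add: no_sides_on_line)
  qed simp
next
  case False
  then have ind: "independent {a, c}" and nd: "\<not> linearly_dependent_pair a c" and "b \<noteq> c"
    using independent_pair_iff[OF assms(5)] by auto
  obtain F :: "'a \<Rightarrow> real" where F: "linear F" "F a = 1" "F c = 1" "affine hull {a, c} = {z. F z = 1}"
    using affine_hull_pair_eq_level_set[OF assms(1) ind assms(5)] .
  obtain l m where lm: "0 \<le> l" "0 \<le> m" and b: "b = l *\<^sub>R a + m *\<^sub>R c"
    using assms(6) unfolding ray_between_def by auto
  have Fb: "F b = l + m"
    using F by (simp add: b linear_add linear_scale)
  have l: "0 < l"
  proof (rule ccontr)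
    assume "\<not> 0 < l"
    then have "b = m *\<^sub>R c" using lm b by simp
    then show False using assms(4,7) lm \<open>b \<noteq> c\<close> by simp
  qed
  note sides = sides_of_level_set[OF F(1,2), of b, folded F(4), unfolded Fb]
  have seg: "closed_segment (sgn (c - a)) (sgn b) \<subseteq> sphere 0 1
        \<longleftrightarrow> norm ((c - a) + b) = norm (c - a) + norm b"
      "closed_segment (sgn (c - a)) (sgn (- c)) \<subseteq> sphere 0 1
        \<longleftrightarrow> norm ((c - a) + (- c)) = norm (c - a) + norm (- c)"
    by (rule closed_segment_sgn_subset_sphere_iff; use assms in simp)+
  consider "l + m > 1" | "l + m = 1" | "l + m < 1" by linarith
  then show ?thesis
  proof cases
    case 1
    note main = norm_diff_le_beyond_line[OF b l lm(2) 1 assms(7)]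
    have "\<not> linearly_dependent_pair (c - a) b"
    proof
      assume "linearly_dependent_pair (c - a) b"
      then obtain r where r: "c - a = r *\<^sub>R b"
        using proportional_if_linearly_dependent_pair assms(3) by metis
      have "F (c - a) = 0" using F by (simp add: linear_diff)
      then have "r * (l + m) = 0" using r Fb F(1) by (simp add: linear_scale)
      then show False using r 1 assms(5) by simp
    qed
    then show ?thesis
      using main 1 \<open>b \<noteq> c\<close>
      unfolding sides seg strictly_convex_def by (auto simp: order.strict_iff_order)
  next
    case 2
    then have "a - b = m *\<^sub>R (a - c)"
      unfolding b using 2[symmetric] by (simp add: algebra_simps flip: scaleR_add_left)
    then have "norm (a - b) = m * norm (a - c)" using lm by simp
    moreover have "m * norm (a - c) < norm (a - c)" using 2 l assms(5) by simp
    ultimately show ?thesis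
      using 2 \<open>b \<noteq> c\<close> unfolding sides by auto
  next
    case 3
    note main = norm_diff_le_before_line[OF b lm 3 assms(7)]
    have "\<not> linearly_dependent_pair (c - a) (- c)"
    proof
      assume "linearly_dependent_pair (c - a) (- c)"
      then obtain r where "c - a = r *\<^sub>R (- c)"
        using proportional_if_linearly_dependent_pair assms(4) by (metis neg_equal_0_iff_equal)
      then have "1 *\<^sub>R a + (- 1 - r) *\<^sub>R c = 0" by (simp add: algebra_simps)
      then show False using nd unfolding linearly_dependent_pair_def by (metis zero_neq_one)
    qed
    then show ?thesis
      using main 3 \<open>b \<noteq> c\<close>
      unfolding sides seg strictly_convex_def by (auto simp: order.strict_iff_order)
  qed
qed

end
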